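(* Let $\tau_1,\tau_2\geq 2$ be real numbers satisfying $2\tau_1<\tau_2+2$, and suppose that $\alpha\in E(\tau_1)$ and $\beta\in W(\tau_2)$. Then any $\alpha\beta$ orbit $(x_n)_{n\geq 0}$ satisfies $$\overline{\dim}_B(\{x_n:n\geq 0\})\geq 1-\frac{2(\tau_1-1)}{\tau_2}.$$
   Context: $\mathbb{T}:=\mathbb{R}/\mathbb{Z}$ is the unit circle, with the distance between two points given by $\|x-y\|$, where $\|\cdot\|$ is the distance to the nearest integer. For $\alpha,\beta\in\mathbb{R}\setminus\mathbb{Q}$, a sequence $(x_n)_{n\geq 0}$ of points in $\mathbb{T}$ is called an $\alpha\beta$ orbit if for every $n\geq 0$ either $x_{n+1}-x_n=\alpha \bmod 1$ or $x_{n+1}-x_n=\beta \bmod 1$. For real $\tau\geq 2$, $W(\tau)$ denotes the set of $x\in\mathbb{R}\setminus\mathbb{Q}$ for which there exist infinitely many $(p,q)\in\mathbb{Z}\times\mathbb{N}$ (with $q\geq 1$) satisfying $\left|x-\frac{p}{q}\right|<\frac{1}{q^{\tau}}$. For $x\in\mathbb{R}\setminus\mathbb{Q}$ the exact order of $x$ is $\tau(x):=\sup\{\tau\geq 2: x\in W(\tau)\}\in[2,\infty]$. For $\tau\in[2,\infty)\cup\{\infty\}$, $E(\tau)$ denotes the set of $x\in\mathbb{R}\setminus\mathbb{Q}$ with $\tau(x)=\tau$. For a bounded set $F$, $N(F,r)$ denotes the minimum number of closed balls of radius $r$ required to cover $F$, and the upper box dimension is $\overline{\dim}_B(F):=\limsup_{r\to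 0}\frac{\log N(F,r)}{-\log r}$. *)

theory Defs
  imports "HOL-Analysis.Analysis"
begin

text \<open>The circle \<open>\<real>/\<int>\<close>; \<open>to_circle\<close> is reduction modulo 1.\<close>

quotient_type circle = real / "\<lambda>x y :: real. x - y \<in> \<int>"
  morphisms rep_circle to_circle
proof (rule equivpI)
  show "reflp (\<lambda>x y :: real. x - y \<in> \<int>)"
    by (simp add: reflp_def)
  show "symp (\<lambda>x y :: real. x - y \<in> \<int>)"
    by (metis (mono_tags, lifting) Ints_minus minus_diff_eq sympI)
  show "transp (\<lambda>x y :: real. x - y \<in> \<int>)"
  proof (rule transpI)
    fix x y z :: real
    assume "x - y \<in> \<int>" "y - z \<in> \<int>"
    then have "(x - y) + (y - z) \<in> \<int>" by (rule Ints_add)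
    then show "x - z \<in> \<int>" by simp
  qed
qed

instantiation circle :: ab_group_add
begin

lift_definition zero_circle :: circle is "0 :: real" .

lift_definition plus_circle :: "circle \<Rightarrow> circle \<Rightarrow> circle" is "(+)"
  by (metis (no_types, lifting) Ints_add add_diff_add)

lift_definition uminus_circle :: "circle \<Rightarrow> circle" is "uminus"
  by (metis Ints_minus minus_diff_minus)

lift_definition minus_circle :: "circle \<Rightarrow> circle \<Rightarrow> circle" is "(-)"
proof -
  fix a b c d :: real
  assume "a - b \<in> \<int>" "c - d \<in> \<int>"
  then have "(a - b) - (c - d) \<in> \<int>" by (rule Ints_diff)
  then show "(a - c) - (b - d) \<in> \<int>" by (simp add: algebra_simps)
qed

instance
  by standard (transfer; simp add: algebra_simps)+

end

definition dist_nearest_int :: "real \<Rightarrow> real"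
  where "dist_nearest_int x = \<bar>x - of_int (round x)\<bar>"

lemma dist_nearest_int_le: "dist_nearest_int x \<le> \<bar>x - of_int m\<bar>"
  unfolding dist_nearest_int_def by (rule round_diff_minimal)

lemma dist_nearest_int_cong_le:
  assumes "x - y \<in> \<int>"
  shows "dist_nearest_int x \<le> dist_nearest_int y"
proof -
  obtain k where k: "x - y = of_int k" using assms by (elim Ints_cases)
  have "dist_nearest_int x \<le> \<bar>x - of_int (round y + k)\<bar>"
    by (rule dist_nearest_int_le)
  also have "x - of_int (round y + k) = y - of_int (round y)"
    using k by simp
  finally show ?thesis by (simp add: dist_nearest_int_def)
qed

lemma dist_nearest_int_cong:
  assumes "x - y \<in> \<int>"
  shows "dist_nearest_int x = dist_nearest_int y"
proof -
  have "y - x \<in> \<int>" using Ints_minus[OF assms] by simp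
  then show ?thesis
    using assms by (intro antisym dist_nearest_int_cong_le)
qed

lemma dist_nearest_int_eq_0_iff: "dist_nearest_int x = 0 \<longleftrightarrow> x \<in> \<int>"
proof
  assume "dist_nearest_int x = 0"
  then have "x = of_int (round x)" by (simp add: dist_nearest_int_def)
  then show "x \<in> \<int>" by (metis Ints_of_int)
next
  assume "x \<in> \<int>"
  then show "dist_nearest_int x = 0"
    by (auto simp: dist_nearest_int_def elim: Ints_cases)
qed

lemma dist_nearest_int_diff_le:
  "dist_nearest_int (x - y) \<le> dist_nearest_int x + dist_nearest_int y"
proof -
  have "dist_nearest_int (x - y) \<le> \<bar>(x - y) - of_int (round x - round y)\<bar>"
    by (rule dist_nearest_int_le)
  also have "\<dots> \<le> dist_nearest_int x + dist_nearest_int y"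
    by (simp add: dist_nearest_int_def)
  finally show ?thesis .
qed

instantiation circle :: metric_space
begin

lift_definition dist_circle :: "circle \<Rightarrow> circle \<Rightarrow> real"
  is "\<lambda>x y. dist_nearest_int (x - y)"
proof (rule dist_nearest_int_cong)
  fix a b c d :: real
  assume "a - b \<in> \<int>" "c - d \<in> \<int>"
  then have "(a - b) - (c - d) \<in> \<int>" by (rule Ints_diff)
  then show "(a - c) - (b - d) \<in> \<int>" by (simp add: algebra_simps)
qed

definition uniformity_circle :: "(circle \<times> circle) filter"
  where "uniformity_circle = (INF e\<in>{0 <..}. principal {(x, y). dist x y < e})"

definition open_circle :: "circle set \<Rightarrow> bool"
  where "open_circle U \<longleftrightarrow> (\<forall>x\<in>U. eventually (\<lambda>(x', y). x' = x \<longrightarrow> y \<in> U) uniformity)"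

instance
proof
  show "uniformity = (INF e\<in>{0 <..}. principal {(x :: circle, y). dist x y < e})"
    by (rule uniformity_circle_def)
  show "open U \<longleftrightarrow> (\<forall>x\<in>U. eventually (\<lambda>(x', y). x' = x \<longrightarrow> y \<in> U) uniformity)"
    for U :: "circle set"
    by (rule open_circle_def)
  show "dist x y = 0 \<longleftrightarrow> x = y" for x y :: circle
    by transfer (rule dist_nearest_int_eq_0_iff)
  show "dist x y \<le> dist x z + dist y z" for x y z :: circle
  proof transfer
    fix x y z :: real
    show "dist_nearest_int (x - y) \<le> dist_nearest_int (x - z) + dist_nearest_int (y - z)"
      using dist_nearest_int_diff_le[of "x - z" "y - z"] by simp
  qed
qed

end

definition alpha_beta_orbit :: "real \<Rightarrow> real \<Rightarrow> (nat \<Rightarrow> circle) \<Rightarrow> bool"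
  where "alpha_beta_orbit \<alpha> \<beta> x \<longleftrightarrow>
    (\<forall>n. x (Suc n) - x n = to_circle \<alpha> \<or> x (Suc n) - x n = to_circle \<beta>)"

text \<open>As usual, the pairs \<open>(p, q)\<close> are not required to be coprime.\<close>

definition approximable :: "real \<Rightarrow> real set"
  where "approximable \<tau> =
    {x. x \<notin> \<rat> \<and>
      infinite {(p :: int, q :: nat). q \<ge> 1 \<and> \<bar>x - real_of_int p / real q\<bar> < 1 / real q powr \<tau>}}"

definition exact_order :: "real \<Rightarrow> ereal"
  where "exact_order x = (SUP \<tau> \<in> {\<tau>. \<tau> \<ge> 2 \<and> x \<in> approximable \<tau>}. ereal \<tau>)"

definition exact_order_set :: "ereal \<Rightarrow> real set"
  where "exact_order_set \<tau> = {x. x \<notin> \<rat> \<and> exact_order x = \<tau>}"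

text \<open>
  The centres of the covering balls range over the ambient space. The minimum is attained
  whenever \<open>F\<close> is totally bounded, in particular for every subset of the circle
  (lemma \<open>circle_finite_cover\<close> below).
\<close>

definition covering_number :: "'a :: metric_space set \<Rightarrow> real \<Rightarrow> nat"
  where "covering_number F r = (LEAST n. \<exists>C. finite C \<and> card C = n \<and> F \<subseteq> (\<Union>c\<in>C. cball c r))"

lemma circle_finite_cover:
  fixes F :: "circle set"
  assumes "r > 0"
  shows "\<exists>C. finite C \<and> F \<subseteq> (\<Union>c\<in>C. cball c r)"
proof -
  obtain m :: nat where m: "m > 0" "1 / real m < r"
    using assms by (metis nat_approx_posE inverse_eq_divide of_nat_0_less_iff zero_less_Suc)
  let ?C = "(\<lambda>k. to_circle (real k / real m)) ` {..m}"
  have "\<exists>c\<in>?C. dist c z \<le> r" for z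
  proof -
    define t where "t = frac (rep_circle z)"
    have z: "z = to_circle t"
      by (metis Quotient3_abs_rep Quotient3_circle Quotient3_rel_abs t_def
          Ints_of_int diff_diff_eq2 add_diff_cancel_left' frac_def)
    have t: "0 \<le> t" "t < 1" by (auto simp: t_def frac_lt_1)
    define k where "k = nat \<lfloor>t * real m\<rfloor>"
    have k: "real k \<le> t * real m" "t * real m < real k + 1"
      using t by (auto simp: k_def)
    have "t * real m \<le> 1 * real m" using t by (intro mult_right_mono) auto
    then have "k \<le> m" using k by simp
    have "dist (to_circle (real k / real m)) z \<le> \<bar>real k / real m - t\<bar>"
      unfolding z dist_circle.abs_eq
      using dist_nearest_int_le[of "real k / real m - t" 0] by simp
    also have "real k / real m - t = (real k - t * real m) / real m"
      using m by (simp add: diff_divide_distrib)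
    also have "\<bar>\<dots>\<bar> = \<bar>real k - t * real m\<bar> / real m"
      by simp
    also have "\<dots> \<le> 1 / real m"
      using k by (intro divide_right_mono) auto
    finally show ?thesis using m \<open>k \<le> m\<close> by force
  qed
  then have "F \<subseteq> (\<Union>c\<in>?C. cball c r)" by auto
  then show ?thesis by blast
qed

definition upper_box_dim :: "'a :: metric_space set \<Rightarrow> ereal"
  where "upper_box_dim F =
    Limsup (at_right 0) (\<lambda>r. ereal (ln (real (covering_number F r)) / (- ln r)))"

end

theory Submission
  imports Defs
begin

text \<open>
  Write the orbit as \<open>x\<^sub>n = x\<^sub>0 + a\<^sub>n \<alpha> + b\<^sub>n \<beta>\<close>, where \<open>a\<^sub>n\<close> and \<open>b\<^sub>n\<close> count the two kinds of
  steps, and let \<open>p/q\<close> be a very good reduced approximation of \<open>\<beta>\<close>. As long as \<open>b\<^sub>n\<close> is not too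
  large, \<open>b\<^sub>n \<beta>\<close> is almost a multiple of \<open>1/q\<close>, which depends only on \<open>b\<^sub>n mod q\<close>. Choose also a
  reduced approximation \<open>c/m\<close> of \<open>\<alpha>\<close> with \<open>m \<le> q\<^bsup>\<tau>/2\<^esup> / 2\<close>: the multiples \<open>a \<alpha>\<close> with
  \<open>0 \<le> a \<le> m/2\<close> are pairwise at distance at least \<open>1/(2m)\<close> on the circle, and over \<open>m/2\<close> steps the
  error \<open>b\<^sub>n |\<beta> - p/q|\<close> is at most \<open>1/(4m)\<close>. Hence a ball of radius \<open>1/(16m)\<close>
  determines \<open>a\<^sub>n\<close> once the residue \<open>b\<^sub>n mod q\<close> is known, so that it contains at most \<open>q\<close> of the
  first \<open>m/2\<close> points of the orbit, provided that the pair \<open>(a\<^sub>n, b\<^sub>n mod q)\<close> determines \<open>n\<close>. At least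
  about \<open>m/(2q)\<close> balls of radius \<open>1/(16m)\<close> are then needed.

  The pair \<open>(a\<^sub>n, b\<^sub>n mod q)\<close> repeats itself only if the orbit makes \<open>q\<close> consecutive steps by
  \<open>\<beta>\<close>. But then it contains \<open>q\<close> points that are nearly a translate of the multiples of \<open>1/q\<close>, and
  even \<open>q\<close> balls of radius \<open>1/(16q)\<close> are needed. The lemma \<open>orbit_covering_dichotomy\<close> makes this
  alternative precise.

  The second case gives dimension 1 at scale \<open>1/q\<close>. The first gives the exponent
  \<open>1 - log q / log m\<close> at scale \<open>1/m\<close>. Dirichlet's theorem with bound \<open>X \<approx> q\<^bsup>\<tau>/2\<^esup>\<close> yields an \<open>m \<le> X\<close>
  with \<open>|\<alpha> - c/m| < 1/(mX)\<close>. If \<open>\<alpha>\<close> is not approximable to the order \<open>\<sigma>\<close>, this forces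
  \<open>m\<^bsup>\<sigma>-1\<^esup>\<close> to be at least a constant times \<open>q\<^bsup>\<tau>/2\<^esup>\<close>. Thus \<open>log q / log m\<close> is at most
  \<open>2(\<sigma> - 1)/\<tau>\<close> in the limit, and \<open>\<sigma>\<close> may be any number above the exact order of \<open>\<alpha>\<close>.
\<close>

section \<open>Distances on the circle\<close>

lemma to_circle_rep: "to_circle (rep_circle z) = z"
  using Quotient3_abs_rep[OF Quotient3_circle] .

lemma dist_to_circle: "dist (to_circle s) (to_circle t) = dist_nearest_int (s - t)"
  by (rule dist_circle.abs_eq)

lemma dist_nearest_int_of_int_add: "dist_nearest_int (of_int k + x) = dist_nearest_int x"
  by (rule dist_nearest_int_cong) simp

lemma dist_nearest_int_le_add_abs: "dist_nearest_int x \<le> dist_nearest_int (x + y) + \<bar>y\<bar>"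
  using dist_nearest_int_diff_le[of "x + y" y] dist_nearest_int_le[of y 0] by simp

text \<open>
  If \<open>m\<close> does not divide \<open>j\<close>, then \<open>j c/m\<close> is a non-integral fraction with denominator \<open>m\<close>, hence
  at distance at least \<open>1/m\<close> from the integers; replacing \<open>c/m\<close> by \<open>\<theta>\<close> moves it by \<open>|j| |\<theta> - c/m|\<close>.
  Applied to both generators, this is the only source of separation between points of the orbit.
\<close>

lemma dist_nearest_int_ge_of_rational_approx:
  fixes \<theta> :: real and c j :: int and m :: nat
  assumes m: "m > 0" and cop: "coprime c (int m)" and ndvd: "\<not> int m dvd j"
  shows "dist_nearest_int (of_int j * \<theta>) \<ge> 1 / real m - \<bar>of_int j\<bar> * \<bar>\<theta> - of_int c / real m\<bar>"
proof -
  define k where "k = round (of_int j * \<theta>)"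
  have "j * c - k * int m \<noteq> 0"
  proof
    assume "j * c - k * int m = 0"
    then have "int m dvd j * c" by (metis dvd_triv_right eq_iff_diff_eq_0)
    with cop have "int m dvd j" by (simp add: coprime_commute coprime_dvd_mult_left_iff)
    with ndvd show False by simp
  qed
  then have "1 \<le> \<bar>j * c - k * int m\<bar>" by linarith
  then have "1 \<le> \<bar>real_of_int j * of_int c - of_int k * real m\<bar>"
    by (metis (mono_tags, opaque_lifting) of_int_1_le_iff of_int_abs of_int_diff of_int_mult of_int_of_nat_eq)
  then have "1 / real m \<le> \<bar>real_of_int j * of_int c - of_int k * real m\<bar> / real m"
    by (rule divide_right_mono) simp
  also have "\<dots> = \<bar>of_int j * (of_int c / real m) - of_int k\<bar>"
  proof -
    have "of_int j * (of_int c / real m) - of_int k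
      = (real_of_int j * of_int c - of_int k * real m) / real m"
      using m by (simp add: field_simps)
    then show ?thesis by simp
  qed
  also have "\<dots> = \<bar>(of_int j * \<theta> - of_int k) - of_int j * (\<theta> - of_int c / real m)\<bar>"
    by (simp add: algebra_simps)
  also have "\<dots> \<le> \<bar>of_int j * \<theta> - of_int k\<bar> + \<bar>of_int j * (\<theta> - of_int c / real m)\<bar>"
    by (rule abs_triangle_ineq4)
  finally show ?thesis
    by (simp add: dist_nearest_int_def k_def abs_mult)
qed

section \<open>Covering an orbit\<close>

text \<open>
  The lower bound for covering numbers is stated for families of points, counted with
  multiplicity, because orbit points are counted by their times.
\<close>

lemma card_le_mult_covering_number:
  fixes x :: "'i \<Rightarrow> circle"
  assumes r: "r > 0" and S: "finite S" and F: "x ` S \<subseteq> F"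
    and ball: "\<And>c. card {i \<in> S. x i \<in> cball c r} \<le> k"
  shows "card S \<le> k * covering_number F r"
proof -
  have "\<exists>n C. finite C \<and> card C = n \<and> F \<subseteq> (\<Union>c\<in>C. cball c r)"
    using circle_finite_cover[OF r, of F] by blast
  then have "\<exists>C. finite C \<and> card C = covering_number F r \<and> F \<subseteq> (\<Union>c\<in>C. cball c r)"
    unfolding covering_number_def by (rule LeastI_ex)
  then obtain C where C: "finite C" "card C = covering_number F r" "F \<subseteq> (\<Union>c\<in>C. cball c r)"
    by blast
  have "S \<subseteq> (\<Union>c\<in>C. {i \<in> S. x i \<in> cball c r})" using C(3) F by fastforce
  then have "card S \<le> card (\<Union>c\<in>C. {i \<in> S. x i \<in> cball c r})"
    using C(1) S by (intro card_mono) auto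
  also have "\<dots> \<le> (\<Sum>c\<in>C. card {i \<in> S. x i \<in> cball c r})" by (rule card_UN_le[OF C(1)])
  also have "\<dots> \<le> (\<Sum>c\<in>C. k)" by (rule sum_mono) (rule ball)
  finally show ?thesis using C(2) by (simp add: mult.commute)
qed

lemma alpha_beta_orbit_step_counts:
  assumes "alpha_beta_orbit \<alpha> \<beta> x"
  obtains a b :: "nat \<Rightarrow> nat" and t :: real
  where "mono a" and "mono b" and "\<And>n. a n + b n = n"
    and "\<And>n. x n = to_circle (t + real (a n) * \<alpha> + real (b n) * \<beta>)"
proof
  define P where "P n \<longleftrightarrow> x (Suc n) - x n = to_circle \<alpha>" for n
  define a where "a n = card {i \<in> {..<n}. P i}" for n
  define b where "b n = card {i \<in> {..<n}. \<not> P i}" for n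
  have aS: "a (Suc n) = a n + (if P n then 1 else 0)" for n
  proof -
    have "{i \<in> {..<Suc n}. P i} = (if P n then insert n {i \<in> {..<n}. P i} else {i \<in> {..<n}. P i})"
      by (auto simp: less_Suc_eq)
    then show ?thesis by (simp add: a_def)
  qed
  have bS: "b (Suc n) = b n + (if P n then 0 else 1)" for n
  proof -
    have "{i \<in> {..<Suc n}. \<not> P i} = (if P n then {i \<in> {..<n}. \<not> P i} else insert n {i \<in> {..<n}. \<not> P i})"
      by (auto simp: less_Suc_eq)
    then show ?thesis by (simp add: b_def)
  qed
  show "mono a" by (simp add: mono_iff_le_Suc aS)
  show "mono b" by (simp add: mono_iff_le_Suc bS)
  show "a n + b n = n" for n
    by (induction n) (simp_all add: aS bS, simp_all add: a_def b_def)
  show "x n = to_circle (rep_circle (x 0) + real (a n) * \<alpha> + real (b n) * \<beta>)" for n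
  proof (induction n)
    case 0
    then show ?case by (simp add: a_def b_def to_circle_rep)
  next
    case (Suc n)
    have step: "x (Suc n) = x n + to_circle (if P n then \<alpha> else \<beta>)"
      using assms unfolding alpha_beta_orbit_def P_def
      by (metis add.commute diff_add_cancel)
    show ?case
      unfolding step by (subst Suc.IH) (simp add: plus_circle.abs_eq aS bS algebra_simps)
  qed
qed

text \<open>
  The two alternatives correspond to whether the orbit ever makes \<open>q\<close> consecutive steps by \<open>\<beta>\<close> or
  not. The three inequalities bound the errors of replacing \<open>\<alpha>\<close> by \<open>c/m\<close> over \<open>m\<close> steps, and \<open>\<beta>\<close> by
  \<open>p/q\<close> over \<open>q\<close> and \<open>m\<close> steps. The factor 16 in the radii leaves room for these errors.
\<close>

lemma orbit_covering_dichotomy: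
  fixes x :: "nat \<Rightarrow> circle" and p c :: int and q m :: nat
  assumes orbit: "alpha_beta_orbit \<alpha> \<beta> x"
    and q: "q > 0" "coprime p (int q)"
    and m: "m > 0" "coprime c (int m)"
    and \<alpha>: "real m * \<bar>\<alpha> - of_int c / real m\<bar> \<le> 1 / real m"
    and \<beta>q: "real q * \<bar>\<beta> - of_int p / real q\<bar> \<le> 1 / (2 * real q)"
    and \<beta>m: "real m * \<bar>\<beta> - of_int p / real q\<bar> \<le> 1 / (4 * real m)"
  shows "q \<le> covering_number (range x) (1 / (16 * real q)) \<or>
    m \<le> 2 * q * covering_number (range x) (1 / (16 * real m))"
proof -
  obtain a b :: "nat \<Rightarrow> nat" and t where mono: "mono a" "mono b" and ab: "\<And>n. a n + b n = n"
    and x: "\<And>n. x n = to_circle (t + real (a n) * \<alpha> + real (b n) * \<beta>)"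
    using alpha_beta_orbit_step_counts[OF orbit] by metis
  \<comment> \<open>Differences of times below \<open>N\<close> are at most \<open>m/2\<close>, so that an error of at most \<open>1/m\<^sup>2\<close> for \<open>\<alpha>\<close>
    costs at most half of the gap \<open>1/m\<close>; rounding up gives \<open>m \<le> 2 N\<close>.\<close>
  define N where "N = (m + 1) div 2"
  have dist: "dist (x n) (x n') = dist_nearest_int
      (of_int (int (a n) - int (a n')) * \<alpha> + of_int (int (b n) - int (b n')) * \<beta>)" for n n'
    by (simp add: x dist_to_circle algebra_simps)
  have two_in_ball: "dist u v \<le> 2 * r" if "u \<in> cball z r" "v \<in> cball z r" for u v z :: circle and r
    using that dist_triangle3[of u v z] by simp
  show ?thesis
  proof (cases "\<exists>n n'. n < n' \<and> a n = a n' \<and> b n mod q = b n' mod q")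
    case True
    then obtain n n' where n: "n < n'" "a n = a n'" "b n mod q = b n' mod q" by blast
    have "b n < b n'" using n(1,2) ab[of n] ab[of n'] by linarith
    then have "q \<le> b n' - b n"
      using n(3) by (metis dvd_imp_le mod_eq_dvd_iff_nat less_imp_le zero_less_diff)
    then have long: "n + q \<le> n'" using n(2) \<open>b n < b n'\<close> ab[of n] ab[of n'] by linarith
    \<comment> \<open>Between the times \<open>n\<close> and \<open>n'\<close> the count of steps by \<open>\<alpha>\<close> is constant.\<close>
    have run: "a (n + i) = a n \<and> b (n + i) = b n + i" if "i < q" for i
    proof -
      have "a n \<le> a (n + i)" "a (n + i) \<le> a n'"
        using that long by (auto intro!: monoD[OF mono(1)])
      then show ?thesis using n(2) ab[of n] ab[of "n + i"] by linarith
    qed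
    have sep: "i = j" if ij: "i < q" "j < q" and
      "x (n + i) \<in> cball z (1 / (16 * real q))" "x (n + j) \<in> cball z (1 / (16 * real q))" for i j z
    proof (rule ccontr)
      assume ne: "i \<noteq> j"
      define k where "k = int i - int j"
      have k: "k \<noteq> 0" "\<bar>k\<bar> < int q" using ne ij by (auto simp: k_def)
      then have "\<not> int q dvd k" using dvd_imp_le_int[of k "int q"] by auto
      from dist_nearest_int_ge_of_rational_approx[OF q this, of \<beta>]
      have "1 / real q - \<bar>of_int k\<bar> * \<bar>\<beta> - of_int p / real q\<bar> \<le> dist_nearest_int (of_int k * \<beta>)" .
      moreover have "\<bar>of_int k\<bar> * \<bar>\<beta> - of_int p / real q\<bar> \<le> real q * \<bar>\<beta> - of_int p / real q\<bar>"
        using k(2) by (intro mult_right_mono) linarith+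
      moreover have "dist_nearest_int (of_int k * \<beta>) = dist (x (n + i)) (x (n + j))"
        using run[OF ij(1)] run[OF ij(2)] by (simp add: dist k_def)
      moreover have "dist (x (n + i)) (x (n + j)) \<le> 2 * (1 / (16 * real q))"
        using that two_in_ball by blast
      ultimately have "1 / real q - 1 / (2 * real q) \<le> 2 * (1 / (16 * real q))" using \<beta>q by linarith
      then show False using q by (simp add: field_simps)
    qed
    have "card {i \<in> {..<q}. x (n + i) \<in> cball z (1 / (16 * real q))} \<le> 1" for z
      using sep by (auto simp: card_le_Suc0_iff_eq)
    then have "card {..<q} \<le> 1 * covering_number (range x) (1 / (16 * real q))"
      using q by (intro card_le_mult_covering_number[where x = "\<lambda>i. x (n + i)"]) auto
    then show ?thesis by simp
  next
    case False
    have sep: "n = n'" if n: "n < N" "n' < N" and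
      ball: "x n \<in> cball z (1 / (16 * real m))" "x n' \<in> cball z (1 / (16 * real m))"
      and mod: "b n mod q = b n' mod q" for n n' z
    proof (rule ccontr)
      assume ne: "n \<noteq> n'"
      define i j where "i = int (a n) - int (a n')" and "j = int (b n) - int (b n')"
      have "a n \<noteq> a n'" using False ne mod by (metis linorder_neqE_nat)
      then have i: "i \<noteq> 0" "2 * \<bar>i\<bar> \<le> int m" and j: "\<bar>j\<bar> \<le> int m"
      proof -
        have "2 * n \<le> m" "2 * n' \<le> m" using n by (simp_all add: N_def)
        moreover have "a n \<le> n" "a n' \<le> n'" "b n \<le> n" "b n' \<le> n'"
          using ab[of n] ab[of n'] by simp_all
        ultimately show "2 * \<bar>i\<bar> \<le> int m" "\<bar>j\<bar> \<le> int m"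
          by (simp_all add: i_def j_def abs_if)
      qed (use \<open>a n \<noteq> a n'\<close> in \<open>simp add: i_def\<close>)
      then have "\<not> int m dvd i" using dvd_imp_le_int[of i "int m"] by auto
      from dist_nearest_int_ge_of_rational_approx[OF m this, of \<alpha>]
      have far: "1 / real m - \<bar>of_int i\<bar> * \<bar>\<alpha> - of_int c / real m\<bar> \<le> dist_nearest_int (of_int i * \<alpha>)" .
      have "2 * \<bar>of_int i\<bar> * \<bar>\<alpha> - of_int c / real m\<bar> \<le> real m * \<bar>\<alpha> - of_int c / real m\<bar>"
        using i(2) by (intro mult_right_mono) linarith+
      with far \<alpha> have far: "1 / (2 * real m) \<le> dist_nearest_int (of_int i * \<alpha>)"
        by simp
      obtain l where l: "j = l * int q"
        using mod by (metis dvd_div_mult_self j_def mod_eq_dvd_iff of_nat_mod)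
      \<comment> \<open>Since \<open>q\<close> divides \<open>j\<close>, the main part of \<open>j \<beta>\<close> vanishes on the circle.\<close>
      have "of_int j * \<beta> = of_int (l * p) + of_int j * (\<beta> - of_int p / real q)"
        using q by (simp add: l algebra_simps)
      then have "dist (x n) (x n') =
          dist_nearest_int (of_int (l * p) + (of_int i * \<alpha> + of_int j * (\<beta> - of_int p / real q)))"
        unfolding dist i_def[symmetric] j_def[symmetric] by (simp only: ac_simps)
      also have "\<dots> = dist_nearest_int (of_int i * \<alpha> + of_int j * (\<beta> - of_int p / real q))"
        by (rule dist_nearest_int_of_int_add)
      finally have "dist_nearest_int (of_int i * \<alpha>)
          \<le> dist (x n) (x n') + \<bar>of_int j * (\<beta> - of_int p / real q)\<bar>"
        using dist_nearest_int_le_add_abs by metis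
      moreover have "\<bar>of_int j * (\<beta> - of_int p / real q)\<bar> \<le> real m * \<bar>\<beta> - of_int p / real q\<bar>"
        unfolding abs_mult using j by (intro mult_right_mono) linarith+
      moreover have "dist (x n) (x n') \<le> 2 * (1 / (16 * real m))"
        using ball two_in_ball by blast
      ultimately have "1 / (2 * real m) \<le> 2 * (1 / (16 * real m)) + 1 / (4 * real m)"
        using far \<beta>m by linarith
      then show False using m by (simp add: field_simps)
    qed
    have "card {n \<in> {..<N}. x n \<in> cball z (1 / (16 * real m))} \<le> q" for z
    proof -
      have "inj_on (\<lambda>n. b n mod q) {n \<in> {..<N}. x n \<in> cball z (1 / (16 * real m))}"
        using sep by (auto intro!: inj_onI)
      then have "card {n \<in> {..<N}. x n \<in> cball z (1 / (16 * real m))} \<le> card {..<q}"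
        using q by (intro card_inj_on_le) auto
      then show ?thesis by simp
    qed
    then have "card {..<N} \<le> q * covering_number (range x) (1 / (16 * real m))"
      using m by (intro card_le_mult_covering_number) auto
    then have "N \<le> q * covering_number (range x) (1 / (16 * real m))" by simp
    moreover have "m \<le> 2 * N" by (simp add: N_def)
    ultimately have "m \<le> 2 * (q * covering_number (range x) (1 / (16 * real m)))" by linarith
    then show ?thesis by (simp add: mult.assoc)
  qed
qed

section \<open>Rational approximations\<close>

text \<open>
  All fractions with denominators up to \<open>Q\<close> lie in the discrete set of multiples of \<open>1/Q!\<close>.
\<close>

lemma irrational_dist_rationals:
  fixes x :: real
  assumes "x \<notin> \<rat>"
  obtains \<delta> where "\<delta> > 0"
    and "\<And>(p :: int) (q :: nat). 1 \<le> q \<Longrightarrow> q \<le> Q \<Longrightarrow> \<delta> \<le> \<bar>x - of_int p / real q\<bar>"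
proof
  define \<delta> where "\<delta> = dist_nearest_int (fact Q * x) / fact Q"
  have "fact Q * x \<notin> \<int>"
  proof
    assume "fact Q * x \<in> \<int>"
    then have "fact Q * x \<in> \<rat>" using Ints_subset_Rats by blast
    then have "fact Q * x / of_nat (fact Q) \<in> \<rat>" by (rule Rats_divide[OF _ Rats_of_nat])
    with assms show False by simp
  qed
  then have "dist_nearest_int (fact Q * x) \<noteq> 0" by (simp add: dist_nearest_int_eq_0_iff)
  then show "\<delta> > 0" by (simp add: \<delta>_def dist_nearest_int_def)
  show "\<delta> \<le> \<bar>x - of_int p / real q\<bar>" if q: "1 \<le> q" "q \<le> Q" for p :: int and q :: nat
  proof -
    obtain l :: nat where l: "fact Q = q * l"
      using dvd_fact[OF q] by (elim dvdE)
    then have l': "(fact Q :: real) = real q * real l" by (metis of_nat_fact of_nat_mult)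
    have "dist_nearest_int (fact Q * x) \<le> \<bar>fact Q * x - of_int (int l * p)\<bar>"
      by (rule dist_nearest_int_le)
    also have "fact Q * x - of_int (int l * p) = fact Q * (x - of_int p / real q)"
      using q by (simp add: l' field_simps)
    finally have "dist_nearest_int (fact Q * x) \<le> \<bar>x - of_int p / real q\<bar> * fact Q"
      by (simp add: abs_mult mult.commute)
    then show ?thesis by (simp add: \<delta>_def pos_divide_le_eq)
  qed
qed

text \<open>
  The pairs in the definition of approximability need not be coprime, whereas the separation of
  the multiples of \<open>p/q\<close> needs it. Cancelling a common factor keeps the inequality, as it makes
  the right-hand side larger. The reduced denominator is still large, since fractions with small
  denominators stay away from \<open>x\<close>.
\<close>

lemma approximable_coprime_unbounded:
  assumes "x \<in> approximable \<tau>" and "\<tau> > 0"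
  obtains p :: int and q :: nat
  where "q > Q" "coprime p (int q)" "\<bar>x - of_int p / real q\<bar> < 1 / real q powr \<tau>"
proof -
  define S where "S = {(p :: int, q :: nat). q \<ge> 1 \<and> \<bar>x - of_int p / real q\<bar> < 1 / real q powr \<tau>}"
  have irr: "x \<notin> \<rat>" and inf: "infinite S"
    using assms by (auto simp: approximable_def S_def)
  \<comment> \<open>Each denominator admits only finitely many numerators.\<close>
  have unbounded: "\<exists>p q. (p, q) \<in> S \<and> q > M" for M
  proof (rule ccontr)
    assume neg: "\<not> ?thesis"
    define B where "B = \<lceil>(\<bar>x\<bar> + 1) * real M\<rceil>"
    have "S \<subseteq> {- B..B} \<times> {..M}"
    proof clarify
      fix p q assume pq: "(p, q) \<in> S"
      then have q: "1 \<le> q" "q \<le> M" using neg by (simp add: S_def, meson not_less)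
      have "1 / real q powr \<tau> \<le> 1" using q assms by (simp add: ge_one_powr_ge_zero)
      moreover have "\<bar>x - of_int p / real q\<bar> < 1 / real q powr \<tau>" using pq by (simp add: S_def)
      ultimately have "\<bar>x - of_int p / real q\<bar> < 1" by linarith
      then have "\<bar>of_int p / real q\<bar> \<le> \<bar>x\<bar> + 1" by linarith
      then have "\<bar>of_int p\<bar> \<le> (\<bar>x\<bar> + 1) * real q" using q by (simp add: field_simps)
      also have "\<dots> \<le> (\<bar>x\<bar> + 1) * real M" using q by (intro mult_left_mono) auto
      also have "\<dots> \<le> of_int B" by (simp add: B_def)
      finally show "p \<in> {- B..B} \<and> q \<in> {..M}" using q by auto
    qed
    then show False using inf finite_subset by blast
  qed
  obtain \<delta> where \<delta>: "\<delta> > 0"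
    "\<And>(p :: int) (q :: nat). 1 \<le> q \<Longrightarrow> q \<le> Q \<Longrightarrow> \<delta> \<le> \<bar>x - of_int p / real q\<bar>"
    using irrational_dist_rationals[OF irr, of Q] by blast
  obtain M :: nat where M: "(1 / \<delta>) powr (1 / \<tau>) < real M" using reals_Archimedean2 by blast
  obtain p q where pq: "(p, q) \<in> S" "q > M" using unbounded by blast
  have q: "q > 0" using pq by simp
  have "1 / \<delta> = ((1 / \<delta>) powr (1 / \<tau>)) powr \<tau>" using \<delta>(1) assms by (simp add: powr_powr)
  also have "\<dots> \<le> real q powr \<tau>" using M pq assms by (intro powr_mono2) auto
  finally have small: "1 / real q powr \<tau> \<le> \<delta>" using \<delta>(1) q by (simp add: field_simps)
  define g where "g = gcd p (int q)"
  have g: "g > 0" using q by (simp add: g_def)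
  obtain p' q' where red: "p = p' * g" "int q = q' * g" "coprime p' q'"
    using gcd_coprime_exists[of p "int q"] g unfolding g_def by (metis less_irrefl)
  have "0 < q' * g" using q by (simp flip: red(2))
  then have q': "q' > 0" using g by (simp add: zero_less_mult_iff)
  define n where "n = nat q'"
  have n: "int n = q'" "n \<ge> 1" using q' by (auto simp: n_def)
  have "real_of_int (int q) = of_int (int n * g)" using red(2) n(1) by simp
  then have qn: "real q = real n * of_int g" by simp
  then have eq: "of_int p / real q = of_int p' / real n" using g unfolding qn red(1) by simp
  have "real n * 1 \<le> real n * of_int g" using g by (intro mult_left_mono) auto
  then have "real n \<le> real q" using qn by simp
  then have "1 / real q powr \<tau> \<le> 1 / real n powr \<tau>"
    using n assms by (intro divide_left_mono powr_mono2) auto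
  then have close: "\<bar>x - of_int p' / real n\<bar> < 1 / real n powr \<tau>"
    using pq by (simp add: S_def eq)
  have "\<bar>x - of_int p' / real n\<bar> < \<delta>" using pq small by (simp add: S_def eq)
  then have "n > Q" using \<delta>(2)[of n p'] n by linarith
  then show thesis using that close red(3) n by blast
qed

text \<open>
  The finitely many exceptions to the inequality with constant 1 are absorbed into the constant;
  they are at positive distance because \<open>x\<close> is irrational.
\<close>

lemma not_approximable_lower_bound:
  assumes irr: "x \<notin> \<rat>" and na: "x \<notin> approximable \<sigma>"
  obtains K where "K > 0"
    and "\<And>(c :: int) (m :: nat). m \<ge> 1 \<Longrightarrow> K / real m powr \<sigma> \<le> \<bar>x - of_int c / real m\<bar>"
proof -
  define B where "B = {(c :: int, m :: nat). m \<ge> 1 \<and> \<bar>x - of_int c / real m\<bar> < 1 / real m powr \<sigma>}"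
  have fin: "finite B" using assms by (auto simp: approximable_def B_def)
  define f where "f = (\<lambda>(c :: int, m :: nat). \<bar>x - of_int c / real m\<bar> * real m powr \<sigma>)"
  define K where "K = Min (insert 1 (f ` B))"
  have "f z > 0" if "z \<in> B" for z
  proof -
    obtain c m where z: "z = (c, m)" by (cases z)
    have "x \<noteq> of_int c / real m" using irr by auto
    then show ?thesis using that by (auto simp: z f_def B_def)
  qed
  then have "K > 0" using fin by (auto simp: K_def)
  moreover have "K / real m powr \<sigma> \<le> \<bar>x - of_int c / real m\<bar>" if m: "m \<ge> 1" for c :: int and m :: nat
  proof (cases "(c, m) \<in> B")
    case True
    then have "K \<le> f (c, m)" using fin by (auto simp: K_def)
    then show ?thesis using m by (simp add: f_def field_simps)
  next
    case False
    have "K \<le> 1" using fin by (auto simp: K_def)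
    then have "K / real m powr \<sigma> \<le> 1 / real m powr \<sigma>" by (intro divide_right_mono) auto
    then show ?thesis using False m by (auto simp: B_def)
  qed
  ultimately show thesis using that by blast
qed

lemma not_approximable_if_exact_order_less:
  assumes "exact_order x < ereal \<sigma>" and "\<sigma> \<ge> 2"
  shows "x \<notin> approximable \<sigma>"
proof
  assume "x \<in> approximable \<sigma>"
  then have "ereal \<sigma> \<le> exact_order x"
    unfolding exact_order_def using assms(2) by (intro SUP_upper) auto
  with assms(1) show False by simp
qed

section \<open>The dimension estimate\<close>

lemma upper_box_dim_geI:
  assumes "\<And>d \<epsilon>. d < D \<Longrightarrow> \<epsilon> > 0 \<Longrightarrow>
    \<exists>r. 0 < r \<and> r < \<epsilon> \<and> r < 1 \<and> d * (- ln r) \<le> ln (real (covering_number F r))"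
  shows "ereal D \<le> upper_box_dim F"
proof (rule ccontr)
  assume "\<not> ?thesis"
  then obtain d where d: "upper_box_dim F < ereal d" "d < D"
    using ereal_dense2[of "upper_box_dim F" "ereal D"] by (auto simp: not_le)
  from Limsup_lessD[OF d(1)[unfolded upper_box_dim_def]]
  obtain \<epsilon> where \<epsilon>: "\<epsilon> > 0"
    "\<And>r. 0 < r \<Longrightarrow> r < \<epsilon> \<Longrightarrow> ln (real (covering_number F r)) / (- ln r) < d"
    by (auto simp: eventually_at_right_field)
  obtain r where r: "0 < r" "r < \<epsilon>" "r < 1" "d * (- ln r) \<le> ln (real (covering_number F r))"
    using assms[OF d(2) \<epsilon>(1)] by blast
  have "- ln r > 0" using r by simp
  then have "d \<le> ln (real (covering_number F r)) / (- ln r)" using r(4) by (simp only: pos_le_divide_eq)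
  with \<epsilon>(2)[OF r(1,2)] show False by simp
qed

text \<open>
  The quantitative core: Dirichlet's theorem supplies the approximation of \<open>\<alpha>\<close> that matches a given
  approximation of \<open>\<beta>\<close>, and the rest is bookkeeping of logarithms. Here \<open>\<tau> > 2\<close> makes \<open>\<beta>\<close> so close
  to \<open>p/q\<close> that \<open>q\<close> steps by \<open>\<beta>\<close> stay well separated.
\<close>

lemma orbit_covering_at_small_scale:
  assumes \<tau>: "\<tau> > 2" and \<sigma>: "\<sigma> > 1"
    and \<alpha>: "\<alpha> \<notin> \<rat>" "\<alpha> \<notin> approximable \<sigma>"
    and \<beta>: "\<beta> \<in> approximable \<tau>"
    and orbit: "alpha_beta_orbit \<alpha> \<beta> x"
    and d: "d < 1 - 2 * (\<sigma> - 1) / \<tau>" and \<epsilon>: "\<epsilon> > 0"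
  shows "\<exists>r. 0 < r \<and> r < \<epsilon> \<and> r < 1 \<and> d * (- ln r) \<le> ln (real (covering_number (range x) r))"
proof -
  define D where "D = 1 - 2 * (\<sigma> - 1) / \<tau>"
  have D: "d < D" "D < 1" using \<tau> \<sigma> d by (auto simp: D_def)
  obtain K where K: "K > 0"
    "\<And>(c :: int) (m :: nat). m \<ge> 1 \<Longrightarrow> K / real m powr \<sigma> \<le> \<bar>\<alpha> - of_int c / real m\<bar>"
    using not_approximable_lower_bound[OF \<alpha>] by blast
  define C where "C = ln 4 - ln K"
  \<comment> \<open>Once \<open>ln q\<close> and \<open>ln m\<close> exceed \<open>L\<close>, the scale is below \<open>\<epsilon>\<close> and the additive constants in the
    logarithmic estimates are absorbed by the gap between \<open>d\<close> and the exponent that is obtained,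
    which is 1 in the case of a long run by \<open>\<beta>\<close> and \<open>D\<close> otherwise.\<close>
  define L where "L = max (ln (1 / \<epsilon>))
    (max (d * ln 16 / (1 - d)) ((d * ln 16 + ln 2 + 2 * C / \<tau>) / (D - d)))"
  \<comment> \<open>The bound \<open>q > 3\<close> makes \<open>X\<close> below positive; the last two summands ensure \<open>q\<^bsup>\<tau>-2\<^esup> \<ge> 2\<close> and, through the lower bound for \<open>m\<close> in terms
    of \<open>q\<close>, that \<open>ln m > L\<close>.\<close>
  obtain Q :: nat where Q: "3 + exp L + 2 powr (1 / (\<tau> - 2)) + exp (2 * ((\<sigma> - 1) * L + C) / \<tau>) < real Q"
    using reals_Archimedean2 by blast
  obtain p :: int and q :: nat where pq: "q > Q" "coprime p (int q)"
    and close: "\<bar>\<beta> - of_int p / real q\<bar> < 1 / real q powr \<tau>"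
    using approximable_coprime_unbounded[OF \<beta>, of Q thesis] \<tau> by simp
  have "exp L > 0" "2 powr (1 / (\<tau> - 2)) > 0" "exp (2 * ((\<sigma> - 1) * L + C) / \<tau>) > 0"
    by simp_all
  moreover have "real Q < real q" using pq(1) by simp
  ultimately have "3 < real q" and expL: "exp L < real q"
    and q2: "2 powr (1 / (\<tau> - 2)) < real q" and exp2: "exp (2 * ((\<sigma> - 1) * L + C) / \<tau>) < real q"
    using Q by linarith+
  then have q3: "3 < q" by simp
  then have eq: "exp (ln (real q)) = real q" by simp
  have lnq: "L < ln q" "2 * ((\<sigma> - 1) * L + C) / \<tau> < ln q"
    using expL exp2 unfolding exp_less_cancel_iff[symmetric, of _ "ln (real q)"] eq by simp_all
  \<comment> \<open>The largest bound for \<open>m\<close> (up to rounding) for which \<open>m |\<beta> - p/q| \<le> 1/(4m)\<close> is guaranteed.\<close>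
  define X where "X = nat \<lfloor>real q powr (\<tau> / 2) / 2\<rfloor>"
  have "real q powr 1 \<le> real q powr (\<tau> / 2)" using q3 \<tau> by (intro powr_mono) auto
  then have qX: "2 \<le> real q powr (\<tau> / 2) / 2" using q3 by simp
  have X: "X > 0" "real X \<le> real q powr (\<tau> / 2) / 2" "real q powr (\<tau> / 2) / 4 \<le> real X"
    unfolding X_def using qX by linarith+
  obtain c k where ck: "coprime c k" "0 < k" "k \<le> int X" "\<bar>of_int k * \<alpha> - of_int c\<bar> < 1 / real X"
    using Dirichlet_approx_coprime[OF X(1)] .
  define m where "m = nat k"
  have m: "m > 0" "coprime c (int m)" "m \<le> X" and mX: "\<bar>real m * \<alpha> - of_int c\<bar> < 1 / real X"
    using ck by (simp_all add: m_def)
  have m_eq: "real m * \<bar>\<alpha> - of_int c / real m\<bar> = \<bar>real m * \<alpha> - of_int c\<bar>"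
    using m(1) by (simp add: abs_mult_pos' right_diff_distrib)
  \<comment> \<open>Since \<open>\<alpha>\<close> is not approximable to the order \<open>\<sigma>\<close>, an approximation as good as Dirichlet's for
    the bound \<open>X\<close> cannot have a small denominator.\<close>
  have "K / real m powr \<sigma> * (real m * real X) \<le> \<bar>\<alpha> - of_int c / real m\<bar> * (real m * real X)"
    using K(2)[of m c] m(1) by (intro mult_right_mono) auto
  also have "\<dots> = \<bar>real m * \<alpha> - of_int c\<bar> * real X" by (simp flip: m_eq)
  also have "\<dots> < 1" using mX X(1) by (simp add: field_simps)
  finally have "K * real X * real m < real m powr \<sigma>" using m(1) by (simp add: field_simps)
  also have "real m powr \<sigma> = real m powr (\<sigma> - 1) * real m"
    using m(1) by (simp add: powr_diff)
  finally have "K * real X < real m powr (\<sigma> - 1)" using m(1) by simp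
  moreover have "K * (real q powr (\<tau> / 2) / 4) \<le> K * real X" using X(3) K(1) by (intro mult_left_mono) auto
  ultimately have "K * (real q powr (\<tau> / 2) / 4) < real m powr (\<sigma> - 1)" by linarith
  then have "ln (K * (real q powr (\<tau> / 2) / 4)) < ln (real m powr (\<sigma> - 1))"
    using K(1) q3 m(1) by (subst ln_less_cancel_iff) auto
  then have size: "\<tau> / 2 * ln q < (\<sigma> - 1) * ln m + C"
    using K(1) q3 m(1) by (simp add: ln_mult ln_div ln_powr C_def)
  have "(\<sigma> - 1) * L + C < \<tau> / 2 * ln q" using lnq(2) \<tau> by (simp add: field_simps)
  with size have "(\<sigma> - 1) * L < (\<sigma> - 1) * ln m" by linarith
  then have lnm: "L < ln m" using \<sigma> by simp
  have "ln q < 2 / \<tau> * ((\<sigma> - 1) * ln m + C)" using size \<tau> by (simp add: field_simps)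
  also have "2 / \<tau> * ((\<sigma> - 1) * ln m + C) = ln m - D * ln m + 2 * C / \<tau>"
    using \<tau> by (simp add: D_def field_simps)
  finally have size': "D * ln m < ln m - ln q + 2 * C / \<tau>" by linarith

  have \<alpha>m: "real m * \<bar>\<alpha> - of_int c / real m\<bar> \<le> 1 / real m"
  proof -
    have "1 / real X \<le> 1 / real m" using m by (intro divide_left_mono) auto
    then show ?thesis using mX unfolding m_eq by linarith
  qed
  have \<beta>q: "real q * \<bar>\<beta> - of_int p / real q\<bar> \<le> 1 / (2 * real q)"
  proof -
    have "2 = (2 powr (1 / (\<tau> - 2))) powr (\<tau> - 2)" using \<tau> by (simp add: powr_powr)
    also have "\<dots> \<le> real q powr (\<tau> - 2)" using q2 \<tau> by (intro powr_mono2) auto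
    also have "\<dots> = real q powr \<tau> / (real q * real q)"
      using q3 by (simp add: powr_diff power2_eq_square)
    finally have "2 * (real q * real q) \<le> real q powr \<tau>" using q3 by (simp add: field_simps)
    then have "1 / real q powr \<tau> \<le> 1 / (2 * (real q * real q))"
      using q3 by (intro divide_left_mono) auto
    with close have "\<bar>\<beta> - of_int p / real q\<bar> \<le> 1 / (2 * (real q * real q))" by linarith
    then have "real q * \<bar>\<beta> - of_int p / real q\<bar> \<le> real q * (1 / (2 * (real q * real q)))"
      by (intro mult_left_mono) auto
    then show ?thesis using q3 by simp
  qed
  have \<beta>m: "real m * \<bar>\<beta> - of_int p / real q\<bar> \<le> 1 / (4 * real m)"
  proof -
    have "real m \<le> real q powr (\<tau> / 2) / 2" using m(3) X(2) by linarith
    then have "(2 * real m) * (2 * real m) \<le> real q powr (\<tau> / 2) * real q powr (\<tau> / 2)"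
      by (intro mult_mono) auto
    also have "\<dots> = real q powr \<tau>" by (simp flip: powr_add)
    finally have "1 / real q powr \<tau> \<le> 1 / ((2 * real m) * (2 * real m))"
      using m(1) q3 by (intro divide_left_mono) auto
    with close have "\<bar>\<beta> - of_int p / real q\<bar> \<le> 1 / ((2 * real m) * (2 * real m))" by linarith
    then have "real m * \<bar>\<beta> - of_int p / real q\<bar> \<le> real m * (1 / ((2 * real m) * (2 * real m)))"
      by (intro mult_left_mono) auto
    then show ?thesis using m(1) by simp
  qed

  have scale: "0 < 1 / (16 * real n) \<and> 1 / (16 * real n) < \<epsilon> \<and> 1 / (16 * real n) < 1
      \<and> - ln (1 / (16 * real n)) = ln n + ln 16" if n: "L < ln n" "n > 0" for n :: nat
  proof -
    have "ln (1 / \<epsilon>) < ln n" using n(1) by (simp add: L_def)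
    then have "1 / \<epsilon> < real n" using \<epsilon> n(2) by simp
    then have "1 / real n < \<epsilon>" using \<epsilon> n(2) by (simp add: field_simps)
    moreover have "1 / (16 * real n) \<le> 1 / real n" using n(2) by (simp add: field_simps)
    ultimately show ?thesis using n(2) by (simp add: ln_div ln_mult)
  qed
  consider "q \<le> covering_number (range x) (1 / (16 * real q))"
    | "m \<le> 2 * q * covering_number (range x) (1 / (16 * real m))"
    using orbit_covering_dichotomy[OF orbit _ pq(2) m(1,2) \<alpha>m \<beta>q \<beta>m] q3 by auto
  then show ?thesis
  proof cases
    case 1
    have "d * ln 16 / (1 - d) < ln q" using lnq(1) by (simp add: L_def)
    then have "d * (ln q + ln 16) \<le> ln q" using D by (simp add: field_simps)
    also have "\<dots> \<le> ln (real (covering_number (range x) (1 / (16 * real q))))"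
      using 1 q3 by simp
    finally have v: "d * (- ln (1 / (16 * real q)))
        \<le> ln (real (covering_number (range x) (1 / (16 * real q))))"
      using scale[OF lnq(1)] q3 by simp
    have "q > 0" using q3 by simp
    from scale[OF lnq(1) this] v show ?thesis by blast
  next
    case 2
    define v where "v = covering_number (range x) (1 / (16 * real m))"
    have v: "v > 0" using 2 m(1) by (cases v) (auto simp: v_def)
    have "real m \<le> real (2 * q * v)" using 2 unfolding v_def of_nat_le_iff .
    then have "real m \<le> 2 * real q * real v" by simp
    then have "ln m \<le> ln (2 * real q * real v)" using m(1) by simp
    then have "ln m \<le> ln 2 + ln q + ln v" using v q3 by (simp add: ln_mult)
    moreover have "d * (ln m + ln 16) \<le> D * ln m - ln 2 - 2 * C / \<tau>"
    proof -
      have "(d * ln 16 + ln 2 + 2 * C / \<tau>) / (D - d) < ln m" using lnm by (simp add: L_def)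
      then show ?thesis using D by (simp add: pos_divide_less_eq algebra_simps)
    qed
    ultimately have "d * (ln m + ln 16) \<le> ln v" using size' by linarith
    then have "d * (- ln (1 / (16 * real m))) \<le> ln v" using scale[OF lnm m(1)] by simp
    then show ?thesis using scale[OF lnm m(1)] unfolding v_def by blast
  qed
qed

theorem theorem1p1:
  fixes \<tau>\<^sub>1 \<tau>\<^sub>2 \<alpha> \<beta> :: real and x :: "nat \<Rightarrow> circle"
  assumes "\<tau>\<^sub>1 \<ge> 2" and "\<tau>\<^sub>2 \<ge> 2"
    and "2 * \<tau>\<^sub>1 < \<tau>\<^sub>2 + 2"
    and "\<alpha> \<in> exact_order_set (ereal \<tau>\<^sub>1)"
    and "\<beta> \<in> approximable \<tau>\<^sub>2"
    and "alpha_beta_orbit \<alpha> \<beta> x"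
  shows "upper_box_dim (range x) \<ge> ereal (1 - 2 * (\<tau>\<^sub>1 - 1) / \<tau>\<^sub>2)"
proof (rule upper_box_dim_geI)
  fix d \<epsilon> :: real
  assume d: "d < 1 - 2 * (\<tau>\<^sub>1 - 1) / \<tau>\<^sub>2" and \<epsilon>: "\<epsilon> > 0"
  have \<tau>: "\<tau>\<^sub>2 > 2" using assms(1,3) by linarith
  have "\<tau>\<^sub>1 < 1 + (1 - d) * \<tau>\<^sub>2 / 2" using d \<tau> by (simp add: field_simps)
  then obtain \<sigma> where \<sigma>: "\<tau>\<^sub>1 < \<sigma>" "\<sigma> < 1 + (1 - d) * \<tau>\<^sub>2 / 2" using dense by blast
  have "\<alpha> \<notin> \<rat>" "exact_order \<alpha> < ereal \<sigma>" using assms(4) \<sigma>(1) by (auto simp: exact_order_set_def)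
  then have "\<alpha> \<notin> approximable \<sigma>"
    using assms(1) \<sigma>(1) by (intro not_approximable_if_exact_order_less) auto
  moreover have "d < 1 - 2 * (\<sigma> - 1) / \<tau>\<^sub>2" using \<sigma>(2) \<tau> by (simp add: field_simps)
  ultimately show "\<exists>r. 0 < r \<and> r < \<epsilon> \<and> r < 1
      \<and> d * (- ln r) \<le> ln (real (covering_number (range x) r))"
    using \<open>\<alpha> \<notin> \<rat>\<close> assms(1,5,6) \<sigma>(1) \<tau> \<epsilon> by (intro orbit_covering_at_small_scale) auto
qed

end
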